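(* Let $f:\mathbb{R}^n\to\mathbb{R}$ be closed, proper and $\sigma$-strongly convex with $\sigma>0$, $A\in\mathbb{R}^{l\times n}$, $b\in\mathbb{R}^l$, $\Omega=\{x:Ax=b\}$. Let $\gamma\in(0,2]$, $\tau\in[\frac{2+\gamma}{4},1]$, $r>\|A\|^2$, let $\beta^k>0$ satisfy $$\beta^k(\tau r\beta^k+\sigma)\ge\tau r(\beta^{k+1})^2,\qquad \beta^{k+1}\ge\beta^k\quad\text{for all }k,$$ and let $$D^k=\tau r\beta^kI_n-\beta^kA^TA,\qquad D_1^k=\tau r\beta^kI_n-\tau\beta^kA^TA .$$ Let $\{v^k=(x^k,\lambda^k)\}$ be generated by GPALM $$\begin{cases}x^{k+1}\in\arg\min_{x}\{L_{\beta^k}(x,\lambda^k)+\frac12\|x-x^k\|_{D^k}^2\},\\ \lambda^{k+1}=\lambda^k-\gamma\beta^k(Ax^{k+1}-b),\end{cases}$$ and let $\widetilde v^k=(\widetilde x^k,\widetilde\lambda^k)$ with $\widetilde x^k=x^{k+1}$, $\widetilde\lambda^k=\lambda^k-\beta^k(A\widetilde x^k-b)$. Put $$H^k=\begin{pmatrix}D^k&0\\0&\frac{1}{\gamma\beta^k}I_l\end{pmatrix},\quad G^k=\begin{pmatrix}D^k&0\\0&\frac{2-\gamma}{\beta^k}I_l\end{pmatrix},\quad H_0^k=\begin{pmatrix}\beta^kD_1^k+(1-\tau)(\beta^k)^2A^TA&0\\0&\frac1\gamma I_l\end{pmatrix}.$$ Then the convergence condition (CC3) holds with $r^k=\beta^k$,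 $R=I_n$, $z'=x'$, $z^k=x^{k+1}$, $\Theta^k=0$ and this $H_0^k$: that is, $r^k>0$, $H_0^k\succeq0$, and for every $k$, every $x'\in\Omega$ and $\lambda\in\mathbb{R}^l$, with $v'=(x',\lambda)$, $$\beta^k\left(\|v^{k+1}-v'\|^2_{H^k}+\sigma\|x^{k+1}-x'\|^2-\|v^k-v'\|^2_{H^k}+\|v^k-\widetilde v^k\|^2_{G^k}\right)\ \ge\ \|v^{k+1}-v'\|^2_{H_0^{k+1}}-\|v^k-v'\|^2_{H_0^k}.$$
   Context: $\|y\|_D^2:=y^TDy$ for a symmetric matrix $D$, whether or not $D$ is positive semidefinite ($D^k$ may be indefinite); $\|A\|$ is the spectral norm. $f$ is $\sigma$-strongly convex if $f(y)\ge f(x)+\langle f'(x),y-x\rangle+\frac\sigma2\|y-x\|^2$ for all $x,y$ and all $f'(x)\in\partial f(x)$. The augmented Lagrangian is $L_{\beta}(x,\lambda)=f(x)-\lambda^T(Ax-b)+\frac{\beta}{2}\|Ax-b\|^2$. The general form of condition (CC3) is: for $r^k>0$, $H_0^k\succeq0$, $\Theta^k\ge0$, $$r^k\left(\|v^{k+1}-v'\|^2_{H^k}+\sigma\|z^k-z'\|^2_R-\|v^k-v'\|^2_{H^k}+\|v^k-\widetilde v^k\|^2_{G^k}\right)\ge\|v^{k+1}-v'\|^2_{H_0^{k+1}}-\|v^k-v'\|^2_{H_0^k}+\Theta^{k+1}-\Theta^k.$$ The minimization subproblems are assumed solvable, so that the sequence is well defined. *)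

theory Defs
  imports "HOL-Analysis.Analysis"
begin

definition wnorm2 :: "real^'n^'n \<Rightarrow> real^'n \<Rightarrow> real" where
  "wnorm2 M y = y \<bullet> (M *v y)"

definition psd :: "real^'n^'n \<Rightarrow> bool" where
  "psd M \<longleftrightarrow> transpose M = M \<and> (\<forall>y. 0 \<le> y \<bullet> (M *v y))"

text \<open>Vectors \<open>(x, y)\<close> and block diagonal matrices are indexed by the disjoint sum of the
  index types of their blocks.\<close>

definition join_vec :: "real^'n \<Rightarrow> real^'l \<Rightarrow> real^('n + 'l)" where
  "join_vec x y = (\<chi> i. case i of Inl p \<Rightarrow> x $ p | Inr q \<Rightarrow> y $ q)"

definition block_diag :: "real^'n^'n \<Rightarrow> real^'l^'l \<Rightarrow> real^('n + 'l)^('n + 'l)" where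
  "block_diag M N = (\<chi> i j. case (i, j) of
       (Inl p, Inl q) \<Rightarrow> M $ p $ q
     | (Inr p, Inr q) \<Rightarrow> N $ p $ q
     | _ \<Rightarrow> 0)"

definition proper_fun :: "('a \<Rightarrow> ereal) \<Rightarrow> bool" where
  "proper_fun F \<longleftrightarrow> (\<forall>x. F x \<noteq> - \<infinity>) \<and> (\<exists>x. F x \<noteq> \<infinity>)"

definition closed_fun :: "('a::topological_space \<Rightarrow> ereal) \<Rightarrow> bool" where
  "closed_fun F \<longleftrightarrow> closed {(x, t::real). F x \<le> ereal t}"

definition subdifferential :: "('a::real_inner \<Rightarrow> real) \<Rightarrow> 'a \<Rightarrow> 'a set" where
  "subdifferential f x = {g. \<forall>y. f y \<ge> f x + g \<bullet> (y - x)}"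

text \<open>Convexity is required explicitly: the subgradient inequality alone says nothing at points
  where the subdifferential is empty.\<close>

definition strongly_convex :: "real \<Rightarrow> ('a::real_inner \<Rightarrow> real) \<Rightarrow> bool" where
  "strongly_convex \<sigma> f \<longleftrightarrow> convex_on UNIV f \<and>
     (\<forall>x y. \<forall>g \<in> subdifferential f x.
        f y \<ge> f x + g \<bullet> (y - x) + \<sigma> / 2 * (norm (y - x))\<^sup>2)"

definition aug_lagrangian ::
    "(real^'n \<Rightarrow> real) \<Rightarrow> real^'n^'l \<Rightarrow> real^'l \<Rightarrow> real \<Rightarrow> real^'n \<Rightarrow> real^'l \<Rightarrow> real" where
  "aug_lagrangian f A b \<beta> x lam =
     f x - lam \<bullet> (A *v x - b) + \<beta> / 2 * (norm (A *v x - b))\<^sup>2"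

definition GPALM ::
    "(real^'n \<Rightarrow> real) \<Rightarrow> real^'n^'l \<Rightarrow> real^'l \<Rightarrow> real \<Rightarrow> (nat \<Rightarrow> real) \<Rightarrow> (nat \<Rightarrow> real^'n^'n)
      \<Rightarrow> (nat \<Rightarrow> real^'n) \<Rightarrow> (nat \<Rightarrow> real^'l) \<Rightarrow> bool" where
  "GPALM f A b \<gamma> \<beta> D x lam \<longleftrightarrow> (\<forall>k.
     is_arg_min (\<lambda>y. aug_lagrangian f A b (\<beta> k) y (lam k) + 1 / 2 * wnorm2 (D k) (y - x k))
       (\<lambda>_. True) (x (Suc k)) \<and>
     lam (Suc k) = lam k - (\<gamma> * \<beta> k) *\<^sub>R (A *v x (Suc k) - b))"

text \<open>\<open>S\<close> is the set of reference pairs \<open>(v', z')\<close> for which the inequality is required; the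
  conditions on \<open>r\<close>, \<open>H0\<close> and \<open>\<Theta>\<close> hold even when it is empty.\<close>

definition CC3 ::
    "(nat \<Rightarrow> real) \<Rightarrow> (nat \<Rightarrow> real^'v^'v) \<Rightarrow> (nat \<Rightarrow> real) \<Rightarrow> real \<Rightarrow> real^'m^'m
      \<Rightarrow> (nat \<Rightarrow> real^'v^'v) \<Rightarrow> (nat \<Rightarrow> real^'v^'v)
      \<Rightarrow> (nat \<Rightarrow> real^'v) \<Rightarrow> (nat \<Rightarrow> real^'v) \<Rightarrow> (nat \<Rightarrow> real^'m)
      \<Rightarrow> ((real^'v) \<times> (real^'m)) set \<Rightarrow> bool" where
  "CC3 r H0 \<Theta> \<sigma> R H G v vt z S \<longleftrightarrow>
     (\<forall>k. r k > 0 \<and> psd (H0 k) \<and> \<Theta> k \<ge> 0) \<and>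
     (\<forall>(v', z') \<in> S. \<forall>k.
        r k * (wnorm2 (H k) (v (Suc k) - v') + \<sigma> * wnorm2 R (z k - z')
               - wnorm2 (H k) (v k - v') + wnorm2 (G k) (v k - vt k))
        \<ge> wnorm2 (H0 (Suc k)) (v (Suc k) - v') - wnorm2 (H0 k) (v k - v')
           + \<Theta> (Suc k) - \<Theta> k)"

end

theory Submission
  imports Defs
begin

text \<open>Fix \<open>k\<close> and put \<open>u = x (Suc k) - x'\<close>, \<open>w = x k - x'\<close>. Scaling by \<open>\<beta> k\<close> makes the multiplier block
  of \<open>H k\<close> equal to \<open>I / \<gamma>\<close>, which is that of every \<open>H0 k\<close>, so the terms in \<open>lam - lam'\<close> cancel.
  The multiplier block of \<open>G k\<close> leaves \<open>(2 - \<gamma>) * (\<beta> k)\<^sup>2 * |A u|\<^sup>2\<close>, because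
  \<open>lam k - lamt k = \<beta> k (A x (Suc k) - b)\<close> and \<open>A x' = b\<close>. The \<open>x\<close>-block of \<open>H0 k\<close> is
  \<open>(\<beta> k)\<^sup>2\<close> times \<open>\<tau> r I + (1 - 2 \<tau>) A\<^sup>T A\<close>.

  The growth condition on \<open>\<beta>\<close> says exactly that the surplus \<open>\<beta> k * \<sigma> * |u|\<^sup>2\<close> pays for replacing
  \<open>(\<beta> k)\<^sup>2\<close> by \<open>(\<beta> (Suc k))\<^sup>2\<close> in front of \<open>\<tau> r |u|\<^sup>2\<close>. In front of \<open>|A u|\<^sup>2\<close> the same replacement is
  free, since \<open>1 - 2 \<tau> < 0\<close> and \<open>\<beta>\<close> is nondecreasing. What remains, divided by \<open>(\<beta> k)\<^sup>2\<close>, is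
  nonnegativity of \<open>(2 \<tau> - \<gamma>) |A u|\<^sup>2 + (2 - 2 \<tau>) |A w|\<^sup>2 + \<tau> r |u - w|\<^sup>2 - |A (u - w)|\<^sup>2\<close>. Now
  \<open>r |u - w|\<^sup>2 \<ge> |A (u - w)|\<^sup>2\<close>, and the parallelogram bound
  \<open>|A (u - w)|\<^sup>2 \<le> 2 |A u|\<^sup>2 + 2 |A w|\<^sup>2\<close>, weighted by \<open>1 - \<tau>\<close>, leaves
  \<open>(4 \<tau> - 2 - \<gamma>) |A u|\<^sup>2\<close>: this is where the lower bound \<open>(2 + \<gamma>) / 4\<close> on \<open>\<tau>\<close> comes from.\<close>

lemma sum_over_sum_type:
  fixes g :: "'a::finite + 'b::finite \<Rightarrow> real"
  shows "(\<Sum>i\<in>UNIV. g i) = (\<Sum>p\<in>UNIV. g (Inl p)) + (\<Sum>q\<in>UNIV. g (Inr q))"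
  unfolding UNIV_Plus_UNIV[symmetric] by (subst sum.Plus) simp_all

lemma wnorm2_block_diag:
  "wnorm2 (block_diag M N) (join_vec y z) = wnorm2 M y + wnorm2 N z"
  by (simp add: wnorm2_def block_diag_def join_vec_def inner_vec_def matrix_vector_mult_def
      sum_over_sum_type)

lemma join_vec_diff: "join_vec y z - join_vec y' z' = join_vec (y - y') (z - z')"
  by (simp add: join_vec_def vec_eq_iff split: sum.split)

lemma join_vec_cases:
  fixes u :: "real^('n::finite + 'l::finite)"
  obtains y z where "u = join_vec y z"
proof
  show "u = join_vec (\<chi> p. u $ Inl p) (\<chi> q. u $ Inr q)"
    by (simp add: join_vec_def vec_eq_iff split: sum.split)
qed

lemma transpose_block_diag:
  "transpose (block_diag M N) = block_diag (transpose M) (transpose N)"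
  by (simp add: transpose_def block_diag_def vec_eq_iff split: sum.split)

lemma psd_block_diag:
  assumes "psd M" and "psd N"
  shows "psd (block_diag M N)"
proof -
  have "0 \<le> wnorm2 (block_diag M N) u" for u
  proof -
    obtain y z where "u = join_vec y z"
      by (rule join_vec_cases)
    moreover have "0 \<le> wnorm2 M y" "0 \<le> wnorm2 N z"
      using assms by (simp_all add: psd_def wnorm2_def)
    ultimately show ?thesis
      by (simp add: wnorm2_block_diag)
  qed
  then show ?thesis
    using assms by (simp add: psd_def transpose_block_diag wnorm2_def)
qed

lemma wnorm2_add: "wnorm2 (M + N) y = wnorm2 M y + wnorm2 N y"
  by (simp add: wnorm2_def matrix_vector_mult_add_rdistrib inner_add_right)

lemma wnorm2_diff: "wnorm2 (M - N) y = wnorm2 M y - wnorm2 N y"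
  by (simp add: wnorm2_def matrix_vector_mult_diff_rdistrib inner_diff_right)

lemma wnorm2_scaleR: "wnorm2 (c *\<^sub>R M) y = c * wnorm2 M y"
  by (simp add: wnorm2_def scaleR_matrix_vector_assoc[symmetric])

lemma wnorm2_mat_1: "wnorm2 (mat 1) y = (norm y)\<^sup>2"
  by (simp add: wnorm2_def power2_norm_eq_inner)

lemma wnorm2_gram: "wnorm2 (transpose A ** A) y = (norm (A *v y))\<^sup>2"
  by (simp add: wnorm2_def matrix_vector_mul_assoc[symmetric] dot_lmul_matrix[symmetric]
      power2_norm_eq_inner inner_commute)

lemmas wnorm2_simps = wnorm2_add wnorm2_diff wnorm2_scaleR wnorm2_mat_1 wnorm2_gram

lemma norm_matrix_vector_sq_le:
  fixes A :: "real^'n^'l"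
  assumes "(onorm ((*v) A))\<^sup>2 \<le> r"
  shows "(norm (A *v y))\<^sup>2 \<le> r * (norm y)\<^sup>2"
proof -
  have "norm (A *v y) \<le> onorm ((*v) A) * norm y"
    by (intro onorm matrix_vector_mul_bounded_linear)
  then have "(norm (A *v y))\<^sup>2 \<le> (onorm ((*v) A))\<^sup>2 * (norm y)\<^sup>2"
    using power_mono[of "norm (A *v y)" "onorm ((*v) A) * norm y" 2]
    by (simp add: power_mult_distrib)
  also have "\<dots> \<le> r * (norm y)\<^sup>2"
    using assms by (intro mult_right_mono) auto
  finally show ?thesis .
qed

text \<open>The parallelogram bound costs \<open>2 (1 - \<tau>)\<close> on each of \<open>|a|\<^sup>2\<close> and \<open>|c|\<^sup>2\<close>: it uses up the
  coefficient of \<open>|c|\<^sup>2\<close> and leaves \<open>4 \<tau> - 2 - \<gamma>\<close> on \<open>|a|\<^sup>2\<close>.\<close>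

lemma residual_terms_nonneg:
  fixes a c :: "'a::real_inner"
  assumes "(2 + \<gamma>) / 4 \<le> \<tau>" and "\<tau> \<le> 1" and "(norm (a - c))\<^sup>2 \<le> R"
    and "0 \<le> \<tau>"
  shows "0 \<le> (2 * \<tau> - \<gamma>) * (norm a)\<^sup>2 + (2 - 2 * \<tau>) * (norm c)\<^sup>2 + \<tau> * R - (norm (a - c))\<^sup>2"
proof -
  have "(norm (a - c))\<^sup>2 + (norm (a + c))\<^sup>2 = 2 * (norm a)\<^sup>2 + 2 * (norm c)\<^sup>2"
    by (simp add: power2_norm_eq_inner inner_simps inner_commute)
  then have "(norm (a - c))\<^sup>2 \<le> 2 * (norm a)\<^sup>2 + 2 * (norm c)\<^sup>2"
    using zero_le_power2[of "norm (a + c)"] by linarith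
  then have "(1 - \<tau>) * (norm (a - c))\<^sup>2 \<le> (1 - \<tau>) * (2 * (norm a)\<^sup>2 + 2 * (norm c)\<^sup>2)"
    using assms by (intro mult_left_mono) auto
  moreover have "\<tau> * (norm (a - c))\<^sup>2 \<le> \<tau> * R"
    using assms by (intro mult_left_mono) auto
  moreover have "0 \<le> (4 * \<tau> - 2 - \<gamma>) * (norm a)\<^sup>2"
    using assms by (intro mult_nonneg_nonneg) auto
  ultimately show ?thesis
    by (simp add: algebra_simps)
qed

text \<open>The inequality of the theorem after the multiplier terms have cancelled, with
  \<open>u = x (Suc k) - x'\<close>, \<open>w = x k - x'\<close>, \<open>p = \<beta> k\<close> and \<open>q = \<beta> (Suc k)\<close>.\<close>

lemma primal_decrease:
  fixes A :: "real^'n^'l"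
  assumes \<gamma>: "0 < \<gamma>" and \<tau>: "(2 + \<gamma>) / 4 \<le> \<tau>" "\<tau> \<le> 1" and r: "(onorm ((*v) A))\<^sup>2 \<le> r"
    and p: "0 < p" "p \<le> q" and growth: "\<tau> * r * q\<^sup>2 \<le> p * (\<tau> * r * p + \<sigma>)"
  shows "q\<^sup>2 * (\<tau> * r * (norm u)\<^sup>2 + (1 - 2 * \<tau>) * (norm (A *v u))\<^sup>2)
           - p\<^sup>2 * (\<tau> * r * (norm w)\<^sup>2 + (1 - 2 * \<tau>) * (norm (A *v w))\<^sup>2)
         \<le> p * (p * (\<tau> * r * (norm u)\<^sup>2 - (norm (A *v u))\<^sup>2) + \<sigma> * (norm u)\<^sup>2
                - p * (\<tau> * r * (norm w)\<^sup>2 - (norm (A *v w))\<^sup>2)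
                + p * (\<tau> * r * (norm (w - u))\<^sup>2 - (norm (A *v (w - u)))\<^sup>2)
                + (2 - \<gamma>) * p * (norm (A *v u))\<^sup>2)"
proof -
  define U where "U = (norm u)\<^sup>2"
  define W where "W = (norm w)\<^sup>2"
  define V where "V = (norm (w - u))\<^sup>2"
  define a where "a = (norm (A *v u))\<^sup>2"
  define c where "c = (norm (A *v w))\<^sup>2"
  define e where "e = (norm (A *v (w - u)))\<^sup>2"
  have e: "e = (norm (A *v u - A *v w))\<^sup>2"
    by (simp add: e_def matrix_vector_mult_diff_distrib norm_minus_commute)
  have "0 \<le> (2 * \<tau> - \<gamma>) * a + (2 - 2 * \<tau>) * c + \<tau> * (r * V) - e"
    unfolding e a_def c_def
    by (rule residual_terms_nonneg)
      (use \<gamma> \<tau> norm_matrix_vector_sq_le[OF r, of "w - u"] in \<open>simp_all add: e_def[symmetric] e V_def\<close>)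
  then have "0 \<le> p\<^sup>2 * ((2 * \<tau> - \<gamma>) * a + (2 - 2 * \<tau>) * c + \<tau> * (r * V) - e)"
    by simp
  moreover have "\<tau> * r * q\<^sup>2 * U \<le> p * (\<tau> * r * p + \<sigma>) * U"
    using growth by (intro mult_right_mono) (simp_all add: U_def)
  moreover have "p\<^sup>2 * ((2 * \<tau> - 1) * a) \<le> q\<^sup>2 * ((2 * \<tau> - 1) * a)"
    using p \<gamma> \<tau> by (intro mult_right_mono power_mono mult_nonneg_nonneg) (simp_all add: a_def)
  ultimately show ?thesis
    unfolding U_def[symmetric] W_def[symmetric] V_def[symmetric] a_def[symmetric] c_def[symmetric]
      e_def[symmetric]
    by (simp add: algebra_simps power2_eq_square)
qed

lemma psd_scaled_identity: "0 \<le> c \<Longrightarrow> psd (c *\<^sub>R mat 1 :: real^'n^'n)"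
  by (simp add: psd_def wnorm2_def[symmetric] wnorm2_simps transpose_scalar transpose_mat)

text \<open>The form at \<open>y\<close> is \<open>\<tau> (r |y|\<^sup>2 - |A y|\<^sup>2) + (1 - \<tau>) |A y|\<^sup>2\<close>, a nonnegative combination even
  though the coefficient \<open>1 - 2 \<tau>\<close> may be negative.\<close>

lemma psd_identity_plus_gram:
  fixes A :: "real^'n^'l"
  assumes "0 \<le> \<tau>" and "\<tau> \<le> 1" and "(onorm ((*v) A))\<^sup>2 \<le> r"
  shows "psd ((\<tau> * r) *\<^sub>R mat 1 + (1 - 2 * \<tau>) *\<^sub>R (transpose A ** A))"
proof -
  let ?M = "(\<tau> * r) *\<^sub>R mat 1 + (1 - 2 * \<tau>) *\<^sub>R (transpose A ** A)"
  have "transpose ?M = ?M"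
    by (simp add: transpose_def vec_eq_iff mat_def matrix_matrix_mult_def mult.commute)
  moreover have "0 \<le> wnorm2 ?M y" for y
  proof -
    have "\<tau> * (norm (A *v y))\<^sup>2 \<le> \<tau> * (r * (norm y)\<^sup>2)"
      using assms by (intro mult_left_mono norm_matrix_vector_sq_le)
    moreover have "0 \<le> (1 - \<tau>) * (norm (A *v y))\<^sup>2"
      using assms by simp
    ultimately show ?thesis
      by (simp add: wnorm2_simps algebra_simps)
  qed
  ultimately show ?thesis
    by (simp add: psd_def wnorm2_def)
qed

lemma psd_scaleR:
  assumes "0 \<le> c" and "psd M"
  shows "psd (c *\<^sub>R M)"
  using assms
  by (simp add: psd_def transpose_scalar scaleR_matrix_vector_assoc[symmetric])

theorem theorem3p2:
  fixes f :: "real^'n \<Rightarrow> real"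
    and A :: "real^'n^'l" and b :: "real^'l" and \<Omega> :: "(real^'n) set"
    and \<sigma> \<gamma> \<tau> r :: real and \<beta> :: "nat \<Rightarrow> real"
    and D D1 :: "nat \<Rightarrow> real^'n^'n"
    and x xt :: "nat \<Rightarrow> real^'n" and lam lamt :: "nat \<Rightarrow> real^'l"
    and v vt :: "nat \<Rightarrow> real^('n + 'l)"
    and H G H0 :: "nat \<Rightarrow> real^('n + 'l)^('n + 'l)"
  assumes "closed_fun (\<lambda>y. ereal (f y))" and "proper_fun (\<lambda>y. ereal (f y))"
    and "\<sigma> > 0" and "strongly_convex \<sigma> f"
    and "\<Omega> = {y. A *v y = b}"
    and "0 < \<gamma>" and "\<gamma> \<le> 2"
    and "(2 + \<gamma>) / 4 \<le> \<tau>" and "\<tau> \<le> 1"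
    and "r > (onorm ((*v) A))\<^sup>2"
    and "\<forall>k. \<beta> k > 0"
    and "\<forall>k. \<beta> k * (\<tau> * r * \<beta> k + \<sigma>) \<ge> \<tau> * r * (\<beta> (Suc k))\<^sup>2"
    and "\<forall>k. \<beta> (Suc k) \<ge> \<beta> k"
    and "\<forall>k. D k = (\<tau> * r * \<beta> k) *\<^sub>R mat 1 - \<beta> k *\<^sub>R (transpose A ** A)"
    and "\<forall>k. D1 k = (\<tau> * r * \<beta> k) *\<^sub>R mat 1 - (\<tau> * \<beta> k) *\<^sub>R (transpose A ** A)"
    and "GPALM f A b \<gamma> \<beta> D x lam"
    and "\<forall>k. xt k = x (Suc k)"
    and "\<forall>k. lamt k = lam k - \<beta> k *\<^sub>R (A *v xt k - b)"
    and "\<forall>k. v k = join_vec (x k) (lam k)"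
    and "\<forall>k. vt k = join_vec (xt k) (lamt k)"
    and "\<forall>k. H k = block_diag (D k) ((1 / (\<gamma> * \<beta> k)) *\<^sub>R mat 1)"
    and "\<forall>k. G k = block_diag (D k) (((2 - \<gamma>) / \<beta> k) *\<^sub>R mat 1)"
    and "\<forall>k. H0 k = block_diag
                (\<beta> k *\<^sub>R D1 k + ((1 - \<tau>) * (\<beta> k)\<^sup>2) *\<^sub>R (transpose A ** A))
                ((1 / \<gamma>) *\<^sub>R mat 1)"
  shows "CC3 \<beta> H0 (\<lambda>k. 0) \<sigma> (mat 1) H G v vt (\<lambda>k. x (Suc k))
           {(join_vec x' lam', x') | x' lam'. x' \<in> \<Omega>}"
proof -
  note \<gamma> = \<open>0 < \<gamma>\<close> \<open>\<gamma> \<le> 2\<close>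
  note \<tau> = \<open>(2 + \<gamma>) / 4 \<le> \<tau>\<close> \<open>\<tau> \<le> 1\<close>
  note \<beta>_pos = \<open>\<forall>k. \<beta> k > 0\<close>
  note \<beta>_growth = \<open>\<forall>k. \<beta> k * (\<tau> * r * \<beta> k + \<sigma>) \<ge> \<tau> * r * (\<beta> (Suc k))\<^sup>2\<close>
  note \<beta>_mono = \<open>\<forall>k. \<beta> (Suc k) \<ge> \<beta> k\<close>
  note D = \<open>\<forall>k. D k = _\<close> and D1 = \<open>\<forall>k. D1 k = _\<close>
  note H = \<open>\<forall>k. H k = _\<close> and G = \<open>\<forall>k. G k = _\<close> and H0 = \<open>\<forall>k. H0 k = _\<close>
  note v = \<open>\<forall>k. v k = _\<close> and vt = \<open>\<forall>k. vt k = _\<close>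
  note xt = \<open>\<forall>k. xt k = _\<close> and lamt = \<open>\<forall>k. lamt k = _\<close>
  have r: "(onorm ((*v) A))\<^sup>2 \<le> r"
    using \<open>r > (onorm ((*v) A))\<^sup>2\<close> by simp
  have H0': "H0 k = block_diag
      ((\<beta> k)\<^sup>2 *\<^sub>R ((\<tau> * r) *\<^sub>R mat 1 + (1 - 2 * \<tau>) *\<^sub>R (transpose A ** A))) ((1 / \<gamma>) *\<^sub>R mat 1)" for k
  proof -
    have "\<beta> k *\<^sub>R D1 k + ((1 - \<tau>) * (\<beta> k)\<^sup>2) *\<^sub>R (transpose A ** A)
      = (\<beta> k)\<^sup>2 *\<^sub>R ((\<tau> * r) *\<^sub>R mat 1 + (1 - 2 * \<tau>) *\<^sub>R (transpose A ** A))"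
      by (simp add: D1 vec_eq_iff algebra_simps power2_eq_square)
    then show ?thesis
      by (simp add: H0)
  qed
  have psd_H0: "psd (H0 k)" for k
    unfolding H0' using \<gamma> \<tau> r
    by (intro psd_block_diag psd_scaleR psd_identity_plus_gram psd_scaled_identity) simp_all
  have descent: "wnorm2 (H0 (Suc k)) (v (Suc k) - v') - wnorm2 (H0 k) (v k - v')
      \<le> \<beta> k * (wnorm2 (H k) (v (Suc k) - v') + \<sigma> * wnorm2 (mat 1) (x (Suc k) - x')
               - wnorm2 (H k) (v k - v') + wnorm2 (G k) (v k - vt k))"
    if x': "x' \<in> \<Omega>" and v': "v' = join_vec x' lam'" for k x' lam' v'
  proof -
    define u where "u = x (Suc k) - x'"
    define w where "w = x k - x'"
    define L where "L = (norm (lam k - lam'))\<^sup>2"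
    define L' where "L' = (norm (lam (Suc k) - lam'))\<^sup>2"
    have \<beta>: "\<beta> k > 0"
      using \<beta>_pos by simp
    have "A *v x' = b"
      using x' \<open>\<Omega> = _\<close> by simp
    then have Au: "A *v x (Suc k) - b = A *v u"
      by (simp add: u_def matrix_vector_mult_diff_distrib)
    have wu: "x k - x (Suc k) = w - u"
      by (simp add: u_def w_def)
    have v_minus: "v i - v' = join_vec (x i - x') (lam i - lam')" for i
      by (simp add: v v' join_vec_diff)
    have "v k - vt k = join_vec (w - u) (\<beta> k *\<^sub>R (A *v u))"
      by (simp add: v vt xt lamt join_vec_diff wu Au)
    then have G_term: "wnorm2 (G k) (v k - vt k)
        = \<beta> k * (\<tau> * r * (norm (w - u))\<^sup>2 - (norm (A *v (w - u)))\<^sup>2)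
          + (2 - \<gamma>) * \<beta> k * (norm (A *v u))\<^sup>2"
      using \<beta> by (simp add: G D wnorm2_block_diag wnorm2_simps power_mult_distrib
          power2_eq_square field_simps)
    have H_u: "wnorm2 (H k) (v (Suc k) - v')
        = \<beta> k * (\<tau> * r * (norm u)\<^sup>2 - (norm (A *v u))\<^sup>2) + L' / (\<gamma> * \<beta> k)"
      unfolding v_minus
      by (simp add: H D wnorm2_block_diag wnorm2_simps u_def L'_def algebra_simps)
    have H_w: "wnorm2 (H k) (v k - v')
        = \<beta> k * (\<tau> * r * (norm w)\<^sup>2 - (norm (A *v w))\<^sup>2) + L / (\<gamma> * \<beta> k)"
      unfolding v_minus
      by (simp add: H D wnorm2_block_diag wnorm2_simps w_def L_def algebra_simps)
    have H0_u: "wnorm2 (H0 (Suc k)) (v (Suc k) - v')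
        = (\<beta> (Suc k))\<^sup>2 * (\<tau> * r * (norm u)\<^sup>2 + (1 - 2 * \<tau>) * (norm (A *v u))\<^sup>2) + L' / \<gamma>"
      unfolding v_minus
      by (simp add: H0' wnorm2_block_diag wnorm2_simps u_def L'_def)
    have H0_w: "wnorm2 (H0 k) (v k - v')
        = (\<beta> k)\<^sup>2 * (\<tau> * r * (norm w)\<^sup>2 + (1 - 2 * \<tau>) * (norm (A *v w))\<^sup>2) + L / \<gamma>"
      unfolding v_minus
      by (simp add: H0' wnorm2_block_diag wnorm2_simps w_def L_def)
    have cancel: "\<beta> k * (M / (\<gamma> * \<beta> k)) = M / \<gamma>" for M
      using \<beta> by simp
    have "(\<beta> (Suc k))\<^sup>2 * (\<tau> * r * (norm u)\<^sup>2 + (1 - 2 * \<tau>) * (norm (A *v u))\<^sup>2)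
          - (\<beta> k)\<^sup>2 * (\<tau> * r * (norm w)\<^sup>2 + (1 - 2 * \<tau>) * (norm (A *v w))\<^sup>2)
        \<le> \<beta> k * (\<beta> k * (\<tau> * r * (norm u)\<^sup>2 - (norm (A *v u))\<^sup>2) + \<sigma> * (norm u)\<^sup>2
                - \<beta> k * (\<tau> * r * (norm w)\<^sup>2 - (norm (A *v w))\<^sup>2)
                + \<beta> k * (\<tau> * r * (norm (w - u))\<^sup>2 - (norm (A *v (w - u)))\<^sup>2)
                + (2 - \<gamma>) * \<beta> k * (norm (A *v u))\<^sup>2)"
      using \<gamma> \<tau> r \<beta> \<beta>_mono \<beta>_growth by (intro primal_decrease) simp_all
    then show ?thesis
      unfolding G_term H_u H_w H0_u H0_w wnorm2_mat_1 u_def[symmetric]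
      using cancel[of L] cancel[of L'] unfolding distrib_left right_diff_distrib by linarith
  qed
  show ?thesis
    unfolding CC3_def using \<beta>_pos psd_H0 descent by auto
qed

end
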